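(* Let $F$ be a $\lambda$-term that is not normalizable, has exactly one free variable $x$, and satisfies $x\in\beta\Omega(F)$, and let $A$ be a closed $\lambda$-term with $F[x:=A]\not\simeq F[x:=\Omega]$. Let $(F_k)_{k\in\mathbb{N}}$ be a sequence of terms with $F_0=F$, $F_k\triangleright^* F_{k+1}$ for all $k$ (with a fixed reduction for each $k$), such that every reduct $G$ of $F$ reduces to some $F_k$, and such that $k\mapsto \#(F_k)$ is recursive. Let $\mathcal{T}$ be the tree whose level $k$ is the set of pure occurrences of $x$ in $F_k$, where an occurrence of $x$ in $F_{k+1}$ is a son of an occurrence of $x$ in $F_k$ if it is a residue of it (under the reduction $F_k\triangleright^*F_{k+1}$). Then $\mathcal{T}$ has an infinite branch that is good, i.e. a sequence $(x_{(k)})_{k\in\mathbb{N}}$ with $x_{(k)}$ a pure occurrence of $x$ in $F_k$, $x_{(k+1)}$ a son of $x_{(k)}$, and each $x_{(k)}$ good in $F_k$.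
   Context: $\triangleright$ is $\beta$-reduction, $\triangleright_\Omega$ is $\Omega$-reduction ($t\triangleright_\Omega\Omega$ when $t$ is unsolvable; $\Omega=(\delta\ \delta)$, $\delta=\lambda x.(x\ x)$), $\triangleright_{\beta\Omega}$ the union of both, and $^*$ denotes reflexive–transitive closure. $u\simeq v$ means $u$ and $v$ have a common $\triangleright_{\beta\Omega}^*$-reduct. $x\in\beta\Omega(t)$ means $x$ occurs free in every $\triangleright_{\beta\Omega}^*$-reduct of $t$. $t[x:=B]$ is substitution; $\#(t)$ is an integer code of $t$. For an occurrence $x_{[i]}$ of $x$ in $t$, $Arg(x_{[i]},t)$ is the maximal list of arguments of $x_{[i]}$ in $t$ (the sequence $V$ such that $([]\ V)$ is the applicative context of $x_{[i]}$). An occurrence $x_{[i]}$ is pure in $t$ if there is no other occurrence $x_{[j]}$ of $x$ in $t$ such that $x_{[i]}$ lies inside an element of $Arg(x_{[j]},t)$. An occurrence $x_{[i]}$ of $x$ in $F_k$ is good in $F_k$ if it is pure in $F_k$ and $u[x:=A]$ is solvable for every subterm $u$ of $F_k$ in which $x_{[i]}$ occurs. (Every pure occurrence of $x$ in $F_{k+1}$ is a residue of a pure occurrence of $x$ in $F_k$, so $\mathcal{T}$ is a tree.) *)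

theory Defs
  imports "HOL-Library.Nat_Bijection" "HOL-Library.Sublist"
begin

text \<open>Lambda terms modulo alpha-equivalence, as de Bruijn terms. A free variable \<open>x\<close> of a term is
  represented by the index \<open>x\<close> outside all binders, hence by \<open>x + n\<close> under \<open>n\<close> binders.\<close>

datatype tm = Var nat | App tm tm | Lam tm

primrec FV :: "tm \<Rightarrow> nat set" where
  "FV (Var i) = {i}"
| "FV (App t u) = FV t \<union> FV u"
| "FV (Lam t) = {i. Suc i \<in> FV t}"

definition closed :: "tm \<Rightarrow> bool" where
  "closed t \<longleftrightarrow> FV t = {}"

primrec rename :: "(nat \<Rightarrow> nat) \<Rightarrow> tm \<Rightarrow> tm" where
  "rename f (Var i) = Var (f i)"
| "rename f (App t u) = App (rename f t) (rename f u)"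
| "rename f (Lam t) = Lam (rename (case_nat 0 (Suc \<circ> f)) t)"

primrec psubst :: "(nat \<Rightarrow> tm) \<Rightarrow> tm \<Rightarrow> tm" where
  "psubst \<sigma> (Var i) = \<sigma> i"
| "psubst \<sigma> (App t u) = App (psubst \<sigma> t) (psubst \<sigma> u)"
| "psubst \<sigma> (Lam t) = Lam (psubst (case_nat (Var 0) (rename Suc \<circ> \<sigma>)) t)"

text \<open>\<open>t[x := B]\<close>, the other free variables keep their index.\<close>

definition subst :: "tm \<Rightarrow> nat \<Rightarrow> tm \<Rightarrow> tm" where
  "subst t x B = psubst (Var(x := B)) t"

text \<open>Positions in a term: \<open>Fn\<close> and \<open>Arg\<close> go to the function and the argument of an application,
  \<open>Body\<close> goes under an abstraction. An occurrence is identified with its position.\<close>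

datatype dir = Fn | Arg | Body

type_synonym pos = "dir list"

fun subterm_at :: "tm \<Rightarrow> pos \<Rightarrow> tm option" where
  "subterm_at t [] = Some t"
| "subterm_at (App t u) (Fn # p) = subterm_at t p"
| "subterm_at (App t u) (Arg # p) = subterm_at u p"
| "subterm_at (Lam t) (Body # p) = subterm_at t p"
| "subterm_at _ _ = None"

definition binders :: "pos \<Rightarrow> nat" where
  "binders p = length (filter (\<lambda>d. d = Body) p)"

definition occurrence :: "nat \<Rightarrow> tm \<Rightarrow> pos \<Rightarrow> bool" where
  "occurrence x t p \<longleftrightarrow> subterm_at t p = Some (Var (x + binders p))"

inductive beta_at :: "pos \<Rightarrow> tm \<Rightarrow> tm \<Rightarrow> bool" where
  "beta_at [] (App (Lam t) u) (psubst (case_nat u Var) t)"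
| "beta_at r t t' \<Longrightarrow> beta_at (Fn # r) (App t u) (App t' u)"
| "beta_at r u u' \<Longrightarrow> beta_at (Arg # r) (App t u) (App t u')"
| "beta_at r t t' \<Longrightarrow> beta_at (Body # r) (Lam t) (Lam t')"

definition beta :: "tm \<Rightarrow> tm \<Rightarrow> bool" where
  "beta t u \<longleftrightarrow> (\<exists>r. beta_at r t u)"

definition normalizable :: "tm \<Rightarrow> bool" where
  "normalizable t \<longleftrightarrow> (\<exists>u. beta\<^sup>*\<^sup>* t u \<and> \<not> (\<exists>v. beta u v))"

text \<open>A term is solvable if some closure of it, applied to suitable arguments, is beta-convertible
  to the identity. Iterated \<open>Lam\<close> abstracts the free variables in the order of their indices
  (possibly with vacuous abstractions); the notion does not depend on the chosen closure.\<close>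

definition solvable :: "tm \<Rightarrow> bool" where
  "solvable t \<longleftrightarrow>
    (\<exists>n us. closed ((Lam ^^ n) t) \<and> equivclp beta (foldl App ((Lam ^^ n) t) us) (Lam (Var 0)))"

definition Omega :: tm where
  "Omega = App (Lam (App (Var 0) (Var 0))) (Lam (App (Var 0) (Var 0)))"

inductive omega_red :: "tm \<Rightarrow> tm \<Rightarrow> bool" where
  "\<not> solvable t \<Longrightarrow> omega_red t Omega"
| "omega_red t t' \<Longrightarrow> omega_red (App t u) (App t' u)"
| "omega_red u u' \<Longrightarrow> omega_red (App t u) (App t u')"
| "omega_red t t' \<Longrightarrow> omega_red (Lam t) (Lam t')"

definition beta_omega :: "tm \<Rightarrow> tm \<Rightarrow> bool" where
  "beta_omega t u \<longleftrightarrow> beta t u \<or> omega_red t u"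

definition sim :: "tm \<Rightarrow> tm \<Rightarrow> bool" (infix "\<simeq>" 50) where
  "u \<simeq> v \<longleftrightarrow> (\<exists>w. beta_omega\<^sup>*\<^sup>* u w \<and> beta_omega\<^sup>*\<^sup>* v w)"

definition persistent_vars :: "tm \<Rightarrow> nat set" ("\<beta>\<Omega>") where
  "\<beta>\<Omega> t = {x. \<forall>u. beta_omega\<^sup>*\<^sup>* t u \<longrightarrow> x \<in> FV u}"

text \<open>A reduction sequence is given by the list of positions of the contracted redexes.\<close>

fun reduction :: "tm \<Rightarrow> pos list \<Rightarrow> tm \<Rightarrow> bool" where
  "reduction t [] u \<longleftrightarrow> t = u"
| "reduction t (r # rs) u \<longleftrightarrow> (\<exists>v. beta_at r t v \<and> reduction v rs u)"

text \<open>Residues of an occurrence of a variable free in \<open>t\<close>, when the redex at \<open>r\<close> is contracted.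
  In the last rule, \<open>y\<close> ranges over the occurrences, in the body of the redex, of the variable
  bound by it: each of them receives a copy of the argument.\<close>

inductive residue1 :: "tm \<Rightarrow> pos \<Rightarrow> pos \<Rightarrow> pos \<Rightarrow> bool" for t r where
  "\<not> prefix r p \<Longrightarrow> residue1 t r p p"
| "residue1 t r (r @ [Fn, Body] @ q) (r @ q)"
| "subterm_at t (r @ [Fn, Body]) = Some b \<Longrightarrow> occurrence 0 b y \<Longrightarrow>
     residue1 t r (r @ [Arg] @ q) (r @ y @ q)"

fun residue :: "tm \<Rightarrow> pos list \<Rightarrow> pos \<Rightarrow> pos \<Rightarrow> bool" where
  "residue t [] p p' \<longleftrightarrow> p = p'"
| "residue t (r # rs) p p' \<longleftrightarrow>
     (\<exists>u q. beta_at r t u \<and> residue1 t r p q \<and> residue u rs q p')"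

text \<open>The arguments of an occurrence, as positions: if \<open>p\<close> ends with exactly \<open>n\<close> steps \<open>Fn\<close>, the
  subterm reached by omitting them is the occurrence applied to \<open>n\<close> arguments.\<close>

definition args :: "pos \<Rightarrow> pos list" where
  "args p = map (\<lambda>i. take (length p - Suc i) p @ [Arg])
              [0..<length (takeWhile (\<lambda>d. d = Fn) (rev p))]"

definition pure_occ :: "nat \<Rightarrow> tm \<Rightarrow> pos \<Rightarrow> bool" where
  "pure_occ x t p \<longleftrightarrow> occurrence x t p \<and>
     \<not> (\<exists>q. occurrence x t q \<and> q \<noteq> p \<and> (\<exists>a \<in> set (args q). prefix a p))"

definition good_occ :: "tm \<Rightarrow> nat \<Rightarrow> tm \<Rightarrow> pos \<Rightarrow> bool" where
  "good_occ A x t p \<longleftrightarrow> pure_occ x t p \<and>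
     (\<forall>q u. prefix q p \<longrightarrow> subterm_at t q = Some u \<longrightarrow> solvable (subst u (x + binders q) A))"

text \<open>The tree of pure occurrences of \<open>x\<close> in the terms \<open>Fs k\<close>, where \<open>\<rho> k\<close> is the chosen reduction
  from \<open>Fs k\<close> to \<open>Fs (Suc k)\<close>.\<close>

definition level :: "nat \<Rightarrow> (nat \<Rightarrow> tm) \<Rightarrow> nat \<Rightarrow> pos set" where
  "level x Fs k = {p. pure_occ x (Fs k) p}"

definition son :: "(nat \<Rightarrow> tm) \<Rightarrow> (nat \<Rightarrow> pos list) \<Rightarrow> nat \<Rightarrow> pos \<Rightarrow> pos \<Rightarrow> bool" where
  "son Fs \<rho> k p p' \<longleftrightarrow> residue (Fs k) (\<rho> k) p p'"

definition infinite_branch ::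
    "nat \<Rightarrow> (nat \<Rightarrow> tm) \<Rightarrow> (nat \<Rightarrow> pos list) \<Rightarrow> (nat \<Rightarrow> pos) \<Rightarrow> bool" where
  "infinite_branch x Fs \<rho> b \<longleftrightarrow> (\<forall>k. b k \<in> level x Fs k \<and> son Fs \<rho> k (b k) (b (Suc k)))"

primrec code :: "tm \<Rightarrow> nat" where
  "code (Var i) = prod_encode (0, i)"
| "code (App t u) = prod_encode (1, prod_encode (code t, code u))"
| "code (Lam t) = prod_encode (2, code t)"

text \<open>\<open>recursive_fn n f\<close>: on argument lists of length \<open>n\<close>, \<open>f\<close> is a total recursive function (closure
  of the basic functions under composition, primitive recursion and minimization of regular
  functions). Values on lists of other lengths are irrelevant.\<close>

inductive recursive_fn :: "nat \<Rightarrow> (nat list \<Rightarrow> nat) \<Rightarrow> bool" where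
  zero: "recursive_fn n (\<lambda>v. 0)"
| succ: "recursive_fn 1 (\<lambda>v. Suc (v ! 0))"
| proj: "i < n \<Longrightarrow> recursive_fn n (\<lambda>v. v ! i)"
| comp: "recursive_fn (length gs) f \<Longrightarrow> (\<And>g. g \<in> set gs \<Longrightarrow> recursive_fn n g) \<Longrightarrow>
     recursive_fn n (\<lambda>v. f (map (\<lambda>g. g v) gs))"
| prec: "recursive_fn n f \<Longrightarrow> recursive_fn (Suc (Suc n)) g \<Longrightarrow>
     recursive_fn (Suc n) (\<lambda>v. rec_nat (f (tl v)) (\<lambda>m y. g (m # y # tl v)) (hd v))"
| mu: "recursive_fn (Suc n) f \<Longrightarrow> (\<And>v. length v = n \<Longrightarrow> \<exists>m. f (m # v) = 0) \<Longrightarrow>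
     recursive_fn n (\<lambda>v. LEAST m. f (m # v) = 0)"

definition recursive :: "(nat \<Rightarrow> nat) \<Rightarrow> bool" where
  "recursive f \<longleftrightarrow> (\<exists>g. recursive_fn 1 g \<and> (\<forall>k. f k = g [k]))"

end

theory Submission
  imports Defs "HOL-Library.Confluence"
begin

text \<open>At every level \<open>k\<close> some pure occurrence of \<open>x\<close> in \<open>F\<^sub>k\<close> is good: otherwise every
  occurrence of \<open>x\<close> lies in a subterm \<open>u\<close> with \<open>u[x:=A]\<close> unsolvable, hence with
  \<open>u[x:=\<Omega>]\<close> unsolvable, and replacing these subterms by \<open>\<Omega>\<close> gives a common reduct of
  \<open>F[x:=A]\<close> and \<open>F[x:=\<Omega>]\<close>. Moreover goodness passes from a residue to its ancestor, because
  solvability is inherited backwards along reduction and substitution. Hence the good occurrences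
  form an infinite, finitely branching tree, and Koenig's lemma applies.\<close>

section \<open>Substitution\<close>

text \<open>That unsolvability of \<open>u[x:=A]\<close> forces that of \<open>u[x:=Omega]\<close>
  comes from a simulation: \<open>Omega\<close> reduces only to itself, so a reduction to the
  identity survives when copies of \<open>Omega\<close> are replaced by arbitrary terms. The
  common-reduct argument by itself yields only an occurrence all of whose enclosing subterms stay
  solvable; purity is then gained by choosing one with the fewest argument steps, because the
  function part of a solvable application is solvable. For ancestors, \<open>A\<close> being closed,
  positions and residues of a term persist in its instance at \<open>x := A\<close>. Goodness thus
  becomes purity plus a condition on one path in one term, and this condition is pulled back without
  mentioning \<open>x\<close>: a subterm containing the redex is a beta-expansion, while a subterm
  of the body or the argument of the redex reappears as a substitution instance. Purity is pulled
  back for a combinatorial reason: if \<open>p\<close> lies in an argument of \<open>q\<close>,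
  every residue of \<open>p\<close> lies in an argument of some residue of \<open>q\<close>.\<close>

abbreviation up :: "(nat \<Rightarrow> tm) \<Rightarrow> nat \<Rightarrow> tm" where
  "up \<sigma> \<equiv> case_nat (Var 0) (rename Suc \<circ> \<sigma>)"

lemma rename_rename: "rename f (rename g t) = rename (f \<circ> g) t"
proof (induction t arbitrary: f g)
  case (Lam t)
  have "case_nat 0 (Suc \<circ> f) \<circ> case_nat 0 (Suc \<circ> g) = case_nat 0 (Suc \<circ> (f \<circ> g))"
    by (auto simp: fun_eq_iff split: nat.split)
  with Lam.IH show ?case by (simp only: rename.simps)
qed auto

lemma psubst_rename: "psubst \<sigma> (rename f t) = psubst (\<sigma> \<circ> f) t"
proof (induction t arbitrary: f \<sigma>)
  case (Lam t)
  have "up \<sigma> \<circ> case_nat 0 (Suc \<circ> f) = up (\<sigma> \<circ> f)"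
    by (auto simp: fun_eq_iff split: nat.split)
  with Lam.IH show ?case by (simp only: rename.simps psubst.simps)
qed auto

lemma rename_psubst: "rename f (psubst \<sigma> t) = psubst (rename f \<circ> \<sigma>) t"
proof (induction t arbitrary: f \<sigma>)
  case (Lam t)
  have "rename (case_nat 0 (Suc \<circ> f)) \<circ> up \<sigma> = up (rename f \<circ> \<sigma>)"
    by (auto simp: fun_eq_iff rename_rename comp_def split: nat.split)
  with Lam.IH show ?case by (simp only: rename.simps psubst.simps)
qed auto

lemma psubst_psubst: "psubst \<tau> (psubst \<sigma> t) = psubst (psubst \<tau> \<circ> \<sigma>) t"
proof (induction t arbitrary: \<tau> \<sigma>)
  case (Lam t)
  have "psubst (up \<tau>) \<circ> up \<sigma> = up (psubst \<tau> \<circ> \<sigma>)"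
    by (auto simp: fun_eq_iff psubst_rename rename_psubst comp_def split: nat.split)
  with Lam.IH show ?case by (simp only: rename.simps psubst.simps)
qed auto

lemma psubst_Var: "psubst Var t = t"
proof (induction t)
  case (Lam t)
  have "up Var = Var" by (auto simp: fun_eq_iff split: nat.split)
  with Lam show ?case by simp
qed auto

lemma rename_eq_psubst: "rename f t = psubst (Var \<circ> f) t"
  using rename_psubst[of f Var t] by (simp add: psubst_Var comp_def)

lemma psubst_cong: "(\<And>i. i \<in> FV t \<Longrightarrow> \<sigma> i = \<tau> i) \<Longrightarrow> psubst \<sigma> t = psubst \<tau> t"
proof (induction t arbitrary: \<sigma> \<tau>)
  case (Lam t)
  have "psubst (up \<sigma>) t = psubst (up \<tau>) t"
    by (rule Lam.IH) (use Lam.prems in \<open>auto split: nat.split\<close>)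
  then show ?case by simp
next
  case (App t u)
  have "psubst \<sigma> t = psubst \<tau> t" "psubst \<sigma> u = psubst \<tau> u"
    by (rule App.IH, use App.prems in simp)+
  then show ?case by simp
qed simp

lemma psubst_closed: "closed t \<Longrightarrow> psubst \<sigma> t = t"
  using psubst_cong[of t \<sigma> Var] by (simp add: closed_def psubst_Var)

lemma rename_closed: "closed t \<Longrightarrow> rename f t = t"
  by (simp add: rename_eq_psubst psubst_closed)

text \<open>Contracting a redex whose body already carries a substitution amounts to one
  simultaneous substitution; both the substitution lemma for beta and the treatment of iterated
  abstractions rest on this.\<close>

lemma psubst_case_nat_up: "psubst (case_nat u Var) (psubst (up \<sigma>) t) = psubst (case_nat u \<sigma>) t"
proof -
  have "psubst (case_nat u Var) \<circ> up \<sigma> = case_nat u \<sigma>"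
    by (auto simp: fun_eq_iff psubst_rename comp_def psubst_Var split: nat.split)
  then show ?thesis by (simp add: psubst_psubst)
qed

lemma psubst_case_nat:
  "psubst \<sigma> (psubst (case_nat u Var) t) = psubst (case_nat (psubst \<sigma> u) Var) (psubst (up \<sigma>) t)"
proof -
  have "psubst \<sigma> \<circ> case_nat u Var = case_nat (psubst \<sigma> u) \<sigma>"
    by (auto simp: fun_eq_iff split: nat.split)
  then show ?thesis by (subst psubst_case_nat_up) (simp only: psubst_psubst)
qed

text \<open>A closed \<open>B\<close> is unaffected by the shift at a binder, so only the replaced
  index moves.\<close>

lemma up_fun_upd: "closed B \<Longrightarrow> up (Var(x := B)) = Var(Suc x := B)"
  by (auto simp: fun_eq_iff rename_closed split: nat.split)

lemma up_power_fun_upd: "closed B \<Longrightarrow> (up ^^ n) (Var(x := B)) = Var(x + n := B)"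
  by (induction n) (simp_all only: funpow.simps comp_apply up_fun_upd id_apply add_0_right add_Suc_right)

lemma up_power_less: "i < n \<Longrightarrow> (up ^^ n) \<sigma> i = Var i"
  by (induction n arbitrary: i) (auto split: nat.split)

lemma up_power_ge: "(up ^^ n) \<sigma> (n + i) = rename ((+) n) (\<sigma> i)"
proof (induction n)
  case 0
  have "Var \<circ> (+) 0 = Var" by auto
  then show ?case by (metis add_0 funpow_0 psubst_Var rename_eq_psubst)
next
  case (Suc n)
  have "Suc \<circ> (+) n = (+) (Suc n)" by auto
  moreover have "(up ^^ Suc n) \<sigma> (Suc n + i) = rename Suc ((up ^^ n) \<sigma> (n + i))" by simp
  ultimately show ?case by (simp only: Suc rename_rename)
qed

section \<open>Beta reduction and its confluence\<close>

lemma beta_redex: "beta (App (Lam t) u) (psubst (case_nat u Var) t)"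
  and beta_App1: "beta t t' \<Longrightarrow> beta (App t u) (App t' u)"
  and beta_App2: "beta u u' \<Longrightarrow> beta (App t u) (App t u')"
  and beta_Lam: "beta t t' \<Longrightarrow> beta (Lam t) (Lam t')"
  unfolding beta_def by (blast intro: beta_at.intros)+

lemma beta_induct [consumes 1, case_names redex App1 App2 Lam]:
  assumes "beta t t'"
    and "\<And>t u. P (App (Lam t) u) (psubst (case_nat u Var) t)"
    and "\<And>t t' u. beta t t' \<Longrightarrow> P t t' \<Longrightarrow> P (App t u) (App t' u)"
    and "\<And>t u u'. beta u u' \<Longrightarrow> P u u' \<Longrightarrow> P (App t u) (App t u')"
    and "\<And>t t'. beta t t' \<Longrightarrow> P t t' \<Longrightarrow> P (Lam t) (Lam t')"
  shows "P t t'"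
proof -
  obtain r where "beta_at r t t'" using assms(1) unfolding beta_def by blast
  then show ?thesis by induction (use assms(2-) in \<open>unfold beta_def, blast+\<close>)
qed

lemma rtranclp_map: "r\<^sup>*\<^sup>* x y \<Longrightarrow> (\<And>x y. r x y \<Longrightarrow> s (f x) (f y)) \<Longrightarrow> s\<^sup>*\<^sup>* (f x) (f y)"
  by (induction rule: rtranclp_induct) (auto intro: rtranclp.rtrancl_into_rtrancl)

lemma beta_rtranclp_App: "beta\<^sup>*\<^sup>* t t' \<Longrightarrow> beta\<^sup>*\<^sup>* u u' \<Longrightarrow> beta\<^sup>*\<^sup>* (App t u) (App t' u')"
  using rtranclp_map[of beta t t' beta "\<lambda>t. App t u"] rtranclp_map[of beta u u' beta "App t'"]
  by (meson beta_App1 beta_App2 rtranclp_trans)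

lemma beta_rtranclp_Lam: "beta\<^sup>*\<^sup>* t t' \<Longrightarrow> beta\<^sup>*\<^sup>* (Lam t) (Lam t')"
  by (erule rtranclp_map) (rule beta_Lam)

lemma beta_rtranclp_foldl: "beta\<^sup>*\<^sup>* t t' \<Longrightarrow> beta\<^sup>*\<^sup>* (foldl App t us) (foldl App t' us)"
  by (induction us arbitrary: t t') (auto intro: beta_rtranclp_App)

text \<open>The redex keeps its position \<open>r\<close>. This is what later allows residues in a
  term and in its instance to be compared.\<close>

lemma beta_at_psubst: "beta_at r t t' \<Longrightarrow> beta_at r (psubst \<sigma> t) (psubst \<sigma> t')"
proof (induction arbitrary: \<sigma> rule: beta_at.induct)
  case (1 t u)
  show ?case unfolding psubst_case_nat[of \<sigma>] psubst.simps by (rule beta_at.intros)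
qed (auto intro: beta_at.intros)

lemma beta_psubst: "beta t t' \<Longrightarrow> beta (psubst \<sigma> t) (psubst \<sigma> t')"
  unfolding beta_def by (blast intro: beta_at_psubst)

section \<open>Parallel reduction in the style of Tait and Martin-Loef, and its diamond
  property\<close>

inductive par :: "tm \<Rightarrow> tm \<Rightarrow> bool" where
  par_Var: "par (Var i) (Var i)"
| par_App: "par t t' \<Longrightarrow> par u u' \<Longrightarrow> par (App t u) (App t' u')"
| par_Lam: "par t t' \<Longrightarrow> par (Lam t) (Lam t')"
| par_redex: "par t t' \<Longrightarrow> par u u' \<Longrightarrow> par (App (Lam t) u) (psubst (case_nat u' Var) t')"

inductive_cases par_VarE: "par (Var i) t"
  and par_AppE [consumes 1, case_names App redex]: "par (App t u) v"
  and par_LamE: "par (Lam t) v"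

lemma par_refl: "par t t"
  by (induction t) (auto intro: par.intros)

lemma beta_imp_par: "beta t t' \<Longrightarrow> par t t'"
  by (induction rule: beta_induct) (auto intro: par.intros par_refl)

lemma par_imp_beta_rtranclp: "par t t' \<Longrightarrow> beta\<^sup>*\<^sup>* t t'"
proof (induction rule: par.induct)
  case (par_redex t t' u u')
  have "beta\<^sup>*\<^sup>* (App (Lam t) u) (App (Lam t') u')"
    by (intro beta_rtranclp_App beta_rtranclp_Lam par_redex.IH)
  then show ?case by (rule rtranclp.rtrancl_into_rtrancl) (rule beta_redex)
qed (auto intro: beta_rtranclp_App beta_rtranclp_Lam)

lemma par_rename: "par t t' \<Longrightarrow> par (rename f t) (rename f t')"
proof (induction arbitrary: f rule: par.induct)
  case (par_redex t t' u u')
  have "rename f (psubst (case_nat u' Var) t')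
      = psubst (case_nat (rename f u') Var) (rename (case_nat 0 (Suc \<circ> f)) t')"
    unfolding rename_psubst psubst_rename
    by (rule psubst_cong) (auto split: nat.split)
  with par_redex show ?case by (auto intro: par.par_redex)
qed (auto intro: par.intros)

lemma par_up: "(\<And>i. par (\<sigma> i) (\<tau> i)) \<Longrightarrow> par (up \<sigma> i) (up \<tau> i)"
  by (auto intro: par_Var par_rename split: nat.split)

lemma par_psubst:
  "par t t' \<Longrightarrow> (\<And>i. par (\<sigma> i) (\<tau> i)) \<Longrightarrow> par (psubst \<sigma> t) (psubst \<tau> t')"
proof (induction arbitrary: \<sigma> \<tau> rule: par.induct)
  case (par_redex t t' u u')
  have "par (psubst (up \<sigma>) t) (psubst (up \<tau>) t')"
    by (rule par_redex.IH(1)) (rule par_up[OF par_redex.prems])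
  then show ?case
    unfolding psubst_case_nat[of \<tau>] psubst.simps
    by (intro par.par_redex par_redex.IH(2) par_redex.prems)
next
  case (par_Lam t t')
  have "par (psubst (up \<sigma>) t) (psubst (up \<tau>) t')"
    by (rule par_Lam.IH) (rule par_up[OF par_Lam.prems])
  then show ?case by (simp add: par.par_Lam)
next
  case (par_App t t' u u')
  then show ?case by (simp add: par.par_App)
qed simp

lemma par_diamond: "par t u \<Longrightarrow> par t v \<Longrightarrow> \<exists>w. par u w \<and> par v w"
proof (induction arbitrary: v rule: par.induct)
  case (par_Var i)
  then show ?case by (auto elim: par_VarE intro: par.intros)
next
  case (par_Lam t t')
  then show ?case by (blast elim: par_LamE intro: par.par_Lam)
next
  case (par_App t t' u u')
  from par_App.prems show ?case
  proof (cases rule: par_AppE)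
    case (App t'' u'')
    with par_App.IH show ?thesis by (blast intro: par.par_App)
  next
    case (redex s s'' u'')
    from par_App.hyps(1) redex(1) obtain s' where s': "t' = Lam s'" "par s s'"
      by (blast elim: par_LamE)
    \<comment> \<open>The induction hypothesis concerns the whole abstraction \<open>t\<close>, not
      its body, so the reduct of the body is wrapped in \<open>Lam\<close> again before the join is
      taken.\<close>
    have "par t (Lam s'')" using redex by (simp add: par.par_Lam)
    then obtain w where "par t' w" "par (Lam s'') w" using par_App.IH(1) by blast
    then obtain w' where w': "par s' w'" "par s'' w'" using s' by (blast elim: par_LamE)
    obtain z where "par u' z" "par u'' z" using par_App.IH(2) redex by blast
    then have "par (App t' u') (psubst (case_nat z Var) w') \<and> par v (psubst (case_nat z Var) w')"
      using w' s' redex by (auto intro!: par.par_redex par_psubst par_refl split: nat.split)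
    then show ?thesis by blast
  qed
next
  case (par_redex t t' u u')
  from par_redex.prems show ?case
  proof (cases rule: par_AppE)
    case (App t'' u'')
    then obtain s where s: "t'' = Lam s" "par t s" by (blast elim: par_LamE)
    obtain w where "par t' w" "par s w" using par_redex.IH(1) s by blast
    moreover obtain z where "par u' z" "par u'' z" using par_redex.IH(2) App by blast
    ultimately have "par (psubst (case_nat u' Var) t') (psubst (case_nat z Var) w)
        \<and> par v (psubst (case_nat z Var) w)"
      using App s by (auto intro!: par.par_redex par_psubst par_refl split: nat.split)
    then show ?thesis by blast
  next
    case (redex s s'' u'')
    obtain w where "par t' w" "par s'' w" using par_redex.IH(1) redex by blast
    moreover obtain z where "par u' z" "par u'' z" using par_redex.IH(2) redex by blast
    ultimately have "par (psubst (case_nat u' Var) t') (psubst (case_nat z Var) w)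
        \<and> par v (psubst (case_nat z Var) w)"
      using redex by (auto intro!: par_psubst par_refl split: nat.split)
    then show ?thesis by blast
  qed
qed

lemma par_rtranclp_eq: "par\<^sup>*\<^sup>* = beta\<^sup>*\<^sup>*"
proof (intro antisym predicate2I)
  fix t u
  show "beta\<^sup>*\<^sup>* t u" if "par\<^sup>*\<^sup>* t u"
    using that by induction (blast dest: par_imp_beta_rtranclp intro: rtranclp_trans)+
  show "par\<^sup>*\<^sup>* t u" if "beta\<^sup>*\<^sup>* t u"
    using that by induction (blast dest: beta_imp_par intro: rtranclp.rtrancl_into_rtrancl)+
qed

lemma confluentp_beta: "confluentp beta"
proof -
  have "strong_confluentp par"
  proof
    fix t u v assume "par t u" "par t v"
    then obtain w where "par u w" "par v w" using par_diamond by blast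
    then show "\<exists>w. par\<^sup>*\<^sup>* u w \<and> par\<^sup>=\<^sup>= v w" by (metis r_into_rtranclp sup2CI)
  qed
  then have "confluentp par" by (rule strong_confluentp_imp_confluentp)
  then show ?thesis unfolding confluentp_def rtranclp_conversep par_rtranclp_eq .
qed

lemma beta_rtranclp_Id: "beta\<^sup>*\<^sup>* (Lam (Var 0)) t \<Longrightarrow> t = Lam (Var 0)"
proof (induction rule: rtranclp_induct)
  case (step y z)
  have "\<And>r. \<not> beta_at r (Lam (Var 0)) z" by (auto elim!: beta_at.cases)
  with step show ?case by (auto simp: beta_def)
qed simp

lemma beta_rtranclp_join_Id:
  "beta\<^sup>*\<^sup>* t (Lam (Var 0)) \<Longrightarrow> beta\<^sup>*\<^sup>* t s \<Longrightarrow> beta\<^sup>*\<^sup>* s (Lam (Var 0))"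
  using confluentpD[OF confluentp_beta] beta_rtranclp_Id by metis

text \<open>By confluence convertible terms have a common reduct, and the identity, being normal, is
  its own only reduct.\<close>

lemma equivclp_beta_Id: "equivclp beta t (Lam (Var 0)) \<longleftrightarrow> beta\<^sup>*\<^sup>* t (Lam (Var 0))"
proof
  assume "equivclp beta t (Lam (Var 0))"
  then have "(beta\<^sup>*\<^sup>* OO beta\<inverse>\<inverse>\<^sup>*\<^sup>*) t (Lam (Var 0))"
    using confluentp_beta by (simp add: confluentp_imp_semiconfluentp semiconfluentp_equivclp)
  then show "beta\<^sup>*\<^sup>* t (Lam (Var 0))"
    by (auto simp: rtranclp_conversep dest: beta_rtranclp_Id)
qed (rule rtranclp_into_equivclp)

section \<open>Solvable terms\<close>

text \<open>The first argument goes to the outermost abstraction, which binds the largest index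
  \<open>n - 1\<close>; hence the reversed indexing. The substitution \<open>\<tau>\<close>
  accumulates the arguments already consumed, so that the induction goes through.\<close>

lemma beta_foldl_Lam_power:
  "length us = n \<Longrightarrow> beta\<^sup>*\<^sup>* (foldl App (psubst \<tau> ((Lam ^^ n) t)) us)
     (psubst (\<lambda>i. if i < n then us ! (n - 1 - i) else \<tau> (i - n)) t)"
proof (induction n arbitrary: \<tau> us)
  case (Suc n)
  then obtain u vs where us: "us = u # vs" "length vs = n" by (cases us) auto
  have eq: "(\<lambda>i. if i < n then vs ! (n - 1 - i) else case_nat u \<tau> (i - n))
      = (\<lambda>i. if i < Suc n then us ! (Suc n - 1 - i) else \<tau> (i - Suc n))"
  proof
    fix i
    show "(if i < n then vs ! (n - 1 - i) else case_nat u \<tau> (i - n))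
        = (if i < Suc n then us ! (Suc n - 1 - i) else \<tau> (i - Suc n))"
    proof (cases i n rule: linorder_cases)
      case less
      then have "Suc n - 1 - i = Suc (n - 1 - i)" by simp
      with less us(1) show ?thesis by simp
    next
      case equal
      with us(1) show ?thesis by simp
    next
      case greater
      then have "i - n = Suc (i - Suc n)" by simp
      with greater show ?thesis by simp
    qed
  qed
  have "beta (App (psubst \<tau> ((Lam ^^ Suc n) t)) u) (psubst (case_nat u \<tau>) ((Lam ^^ n) t))"
    using beta_redex[of "psubst (up \<tau>) ((Lam ^^ n) t)" u] by (simp add: psubst_case_nat_up)
  then have "beta\<^sup>*\<^sup>* (foldl App (psubst \<tau> ((Lam ^^ Suc n) t)) us)
      (foldl App (psubst (case_nat u \<tau>) ((Lam ^^ n) t)) vs)"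
    using us beta_rtranclp_foldl by auto
  also have "beta\<^sup>*\<^sup>* \<dots>
      (psubst (\<lambda>i. if i < Suc n then us ! (Suc n - 1 - i) else \<tau> (i - Suc n)) t)"
    unfolding eq[symmetric] by (rule Suc.IH) (rule us(2))
  finally show ?case .
qed simp

lemma finite_FV: "finite (FV t)"
proof (induction t)
  case (Lam t)
  have "Suc ` FV (Lam t) \<subseteq> FV t" by auto
  with Lam show ?case by (metis finite_imageD finite_subset inj_Suc)
qed auto

lemma FV_Lam_power: "FV ((Lam ^^ n) t) = {i. i + n \<in> FV t}"
  by (induction n) auto

text \<open>A characterization without closures, which makes closure properties of solvability immediate.\<close>

lemma solvable_iff:
  "solvable t \<longleftrightarrow> (\<exists>\<sigma> us. beta\<^sup>*\<^sup>* (foldl App (psubst \<sigma> t) us) (Lam (Var 0)))"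
proof
  assume "solvable t"
  then obtain n us where us: "beta\<^sup>*\<^sup>* (foldl App ((Lam ^^ n) t) us) (Lam (Var 0))"
    unfolding solvable_def equivclp_beta_Id by blast
  \<comment> \<open>There may be fewer arguments than abstractions. Appending identities does no
    harm, since the identity applied to itself reduces to itself, and it makes the list long enough
    to feed all \<open>n\<close> abstractions.\<close>
  have "\<exists>vs. length vs \<ge> m \<and> beta\<^sup>*\<^sup>* (foldl App ((Lam ^^ n) t) vs) (Lam (Var 0))" for m
  proof (induction m)
    case (Suc m)
    then obtain vs where vs: "length vs \<ge> m" "beta\<^sup>*\<^sup>* (foldl App ((Lam ^^ n) t) vs) (Lam (Var 0))"
      by blast
    have "beta\<^sup>*\<^sup>* (foldl App ((Lam ^^ n) t) (vs @ [Lam (Var 0)])) (App (Lam (Var 0)) (Lam (Var 0)))"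
      using beta_rtranclp_App[OF vs(2) rtranclp.rtrancl_refl] by simp
    moreover have "beta (App (Lam (Var 0)) (Lam (Var 0))) (Lam (Var 0))"
      using beta_redex[of "Var 0" "Lam (Var 0)"] by simp
    ultimately have "beta\<^sup>*\<^sup>* (foldl App ((Lam ^^ n) t) (vs @ [Lam (Var 0)])) (Lam (Var 0))"
      by (rule rtranclp.rtrancl_into_rtrancl)
    with vs(1) show ?case by (intro exI[of _ "vs @ [Lam (Var 0)]"]) simp
  qed (use us in auto)
  then obtain vs where vs: "beta\<^sup>*\<^sup>* (foldl App ((Lam ^^ n) t) vs) (Lam (Var 0))" "length vs \<ge> n"
    by blast
  let ?\<sigma> = "\<lambda>i. if i < n then take n vs ! (n - 1 - i) else Var (i - n)"
  have *: "beta\<^sup>*\<^sup>* (foldl App ((Lam ^^ n) t) (take n vs)) (psubst ?\<sigma> t)"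
    using beta_foldl_Lam_power[of "take n vs" n Var t] vs(2) by (simp add: psubst_Var)
  have "beta\<^sup>*\<^sup>* (foldl App ((Lam ^^ n) t) vs) (foldl App (psubst ?\<sigma> t) (drop n vs))"
    using beta_rtranclp_foldl[OF *, of "drop n vs"]
    by (simp only: foldl_append[symmetric] append_take_drop_id)
  with vs(1) have "beta\<^sup>*\<^sup>* (foldl App (psubst ?\<sigma> t) (drop n vs)) (Lam (Var 0))"
    by (rule beta_rtranclp_join_Id)
  then show "\<exists>\<sigma> us. beta\<^sup>*\<^sup>* (foldl App (psubst \<sigma> t) us) (Lam (Var 0))" by blast
next
  assume "\<exists>\<sigma> us. beta\<^sup>*\<^sup>* (foldl App (psubst \<sigma> t) us) (Lam (Var 0))"
  then obtain \<sigma> us where us: "beta\<^sup>*\<^sup>* (foldl App (psubst \<sigma> t) us) (Lam (Var 0))" by blast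
  \<comment> \<open>With \<open>n\<close> above all free indices the \<open>n\<close>-fold
    abstraction is closed, and the values of \<open>\<sigma>\<close>, listed in reverse, serve as
    its first \<open>n\<close> arguments.\<close>
  obtain n where n: "\<forall>i \<in> FV t. i < n"
    using finite_FV[of t] unfolding finite_nat_set_iff_bounded by blast
  have closed: "closed ((Lam ^^ n) t)" using n by (auto simp: closed_def FV_Lam_power)
  define vs where "vs = rev (map \<sigma> [0..<n])"
  let ?\<sigma> = "\<lambda>i. if i < n then vs ! (n - 1 - i) else Var (i - n)"
  have "psubst ?\<sigma> t = psubst \<sigma> t"
    by (rule psubst_cong) (use n in \<open>auto simp: vs_def rev_nth\<close>)
  moreover have "beta\<^sup>*\<^sup>* (foldl App ((Lam ^^ n) t) vs) (psubst ?\<sigma> t)"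
    using beta_foldl_Lam_power[of vs n Var t] by (simp add: vs_def psubst_Var)
  ultimately have "beta\<^sup>*\<^sup>* (foldl App ((Lam ^^ n) t) vs) (psubst \<sigma> t)" by (simp only:)
  from rtranclp_trans[OF beta_rtranclp_foldl[OF this] us]
  have "beta\<^sup>*\<^sup>* (foldl App ((Lam ^^ n) t) (vs @ us)) (Lam (Var 0))" by (simp only: foldl_append)
  with closed show "solvable t" unfolding solvable_def equivclp_beta_Id by blast
qed

lemma solvable_psubstD: "solvable (psubst \<sigma> t) \<Longrightarrow> solvable t"
  unfolding solvable_iff psubst_psubst by blast

lemma solvable_AppD: "solvable (App t u) \<Longrightarrow> solvable t"
  unfolding solvable_iff by (metis foldl_Cons psubst.simps(2))

text \<open>The value \<open>\<sigma> 0\<close> used for the bound variable becomes an extra first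
  argument, and one beta step restores the old situation.\<close>

lemma solvable_Lam: "solvable t \<Longrightarrow> solvable (Lam t)"
proof -
  assume "solvable t"
  then obtain \<sigma> us where us: "beta\<^sup>*\<^sup>* (foldl App (psubst \<sigma> t) us) (Lam (Var 0))"
    unfolding solvable_iff by blast
  have "case_nat (\<sigma> 0) (\<sigma> \<circ> Suc) = \<sigma>" by (auto simp: fun_eq_iff split: nat.split)
  then have "beta (App (psubst (\<sigma> \<circ> Suc) (Lam t)) (\<sigma> 0)) (psubst \<sigma> t)"
    using beta_redex[of "psubst (up (\<sigma> \<circ> Suc)) t" "\<sigma> 0"] by (simp add: psubst_case_nat_up)
  then have "beta\<^sup>*\<^sup>* (foldl App (psubst (\<sigma> \<circ> Suc) (Lam t)) (\<sigma> 0 # us))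
      (foldl App (psubst \<sigma> t) us)"
    using beta_rtranclp_foldl by auto
  with us show ?thesis unfolding solvable_iff by (meson rtranclp_trans)
qed

lemma solvable_beta_expand: "beta t t' \<Longrightarrow> solvable t' \<Longrightarrow> solvable t"
  unfolding solvable_iff
  by (meson beta_psubst beta_rtranclp_foldl r_into_rtranclp rtranclp_trans)

text \<open>The right-hand term arises from the left-hand one by putting arbitrary terms for some
  copies of \<open>Omega\<close>; \<open>Omega\<close> thus acts as a least element.\<close>

inductive replaces_Omega :: "tm \<Rightarrow> tm \<Rightarrow> bool" where
  ro_Omega: "replaces_Omega Omega s"
| ro_Var: "replaces_Omega (Var i) (Var i)"
| ro_App: "replaces_Omega t t' \<Longrightarrow> replaces_Omega u u' \<Longrightarrow> replaces_Omega (App t u) (App t' u')"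
| ro_Lam: "replaces_Omega t t' \<Longrightarrow> replaces_Omega (Lam t) (Lam t')"

inductive_cases ro_AppE [consumes 1, case_names Omega App]: "replaces_Omega (App t u) v"
  and ro_LamE: "replaces_Omega (Lam t) v"
  and ro_VarE: "replaces_Omega (Var i) v"

lemma closed_Omega: "closed Omega"
  by (auto simp: closed_def Omega_def)

lemma ro_refl: "replaces_Omega t t"
  by (induction t) (auto intro: replaces_Omega.intros)

lemma ro_rename: "replaces_Omega t t' \<Longrightarrow> replaces_Omega (rename f t) (rename f t')"
  by (induction arbitrary: f rule: replaces_Omega.induct)
    (auto simp: rename_closed closed_Omega intro: replaces_Omega.intros)

lemma ro_psubst:
  "replaces_Omega t t' \<Longrightarrow> (\<And>i. replaces_Omega (\<sigma> i) (\<tau> i))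
    \<Longrightarrow> replaces_Omega (psubst \<sigma> t) (psubst \<tau> t')"
proof (induction arbitrary: \<sigma> \<tau> rule: replaces_Omega.induct)
  case (ro_Lam t t')
  have "replaces_Omega (psubst (up \<sigma>) t) (psubst (up \<tau>) t')"
    by (rule ro_Lam.IH)
      (use ro_Lam.prems in \<open>auto intro: ro_rename replaces_Omega.ro_Var split: nat.split\<close>)
  then show ?case by (simp add: replaces_Omega.ro_Lam)
qed (auto simp: psubst_closed closed_Omega intro: replaces_Omega.intros)

lemma ro_foldl: "replaces_Omega t t' \<Longrightarrow> replaces_Omega (foldl App t us) (foldl App t' us)"
  by (induction us arbitrary: t t') (auto intro: replaces_Omega.ro_App ro_refl)

lemma beta_Omega: "beta Omega t \<Longrightarrow> t = Omega"
  unfolding beta_def Omega_def by (auto elim!: beta_at.cases)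

text \<open>A step inside a replaced copy of \<open>Omega\<close> leads back to \<open>Omega\<close>
  and is answered by no step at all; every other step is copied.\<close>

lemma ro_beta:
  "beta t u \<Longrightarrow> replaces_Omega t t' \<Longrightarrow> \<exists>u'. beta\<^sup>*\<^sup>* t' u' \<and> replaces_Omega u u'"
proof (induction arbitrary: t' rule: beta_induct)
  case (redex a b)
  from redex show ?case
  proof (cases rule: ro_AppE)
    case Omega
    then have "psubst (case_nat b Var) a = Omega" using beta_redex[of a b] beta_Omega by simp
    then show ?thesis using ro_Omega by auto
  next
    case (App s b')
    \<comment> \<open>An abstraction is not \<open>Omega\<close>, so it can only be related to an
      abstraction and the redex survives.\<close>
    then obtain a' where a': "s = Lam a'" "replaces_Omega a a'"
      by (auto elim: ro_LamE simp: Omega_def)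
    then have "replaces_Omega (psubst (case_nat b Var) a) (psubst (case_nat b' Var) a')"
      using App by (auto intro!: ro_psubst ro_refl split: nat.split)
    then show ?thesis using App a' beta_redex by blast
  qed
next
  case (App1 t s u)
  from App1.prems show ?case
  proof (cases rule: ro_AppE)
    case Omega
    then have "App s u = Omega" using beta_App1[OF App1.hyps] beta_Omega by metis
    then show ?thesis using ro_Omega by auto
  next
    case (App t2 u2)
    then show ?thesis using App1.IH beta_rtranclp_App ro_App by blast
  qed
next
  case (App2 t u s)
  from App2.prems show ?case
  proof (cases rule: ro_AppE)
    case Omega
    then have "App t s = Omega" using beta_App2[OF App2.hyps] beta_Omega by metis
    then show ?thesis using ro_Omega by auto
  next
    case (App t2 u2)
    then show ?thesis using App2.IH beta_rtranclp_App ro_App by blast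
  qed
next
  case (Lam t s)
  then obtain t2 where "t' = Lam t2" "replaces_Omega t t2"
    by (auto elim: ro_LamE simp: Omega_def)
  then show ?case using Lam.IH beta_rtranclp_Lam ro_Lam by blast
qed

lemma ro_beta_rtranclp:
  "beta\<^sup>*\<^sup>* t u \<Longrightarrow> replaces_Omega t t' \<Longrightarrow> \<exists>u'. beta\<^sup>*\<^sup>* t' u' \<and> replaces_Omega u u'"
  by (induction rule: rtranclp_induct) (auto, meson ro_beta rtranclp_trans)

text \<open>The simulated reduction must end in the identity, because the identity contains no copy
  of \<open>Omega\<close> that could have been replaced.\<close>

lemma ro_solvable: "replaces_Omega t t' \<Longrightarrow> solvable t \<Longrightarrow> solvable t'"
proof -
  assume "replaces_Omega t t'" "solvable t"
  then obtain \<sigma> us where us: "beta\<^sup>*\<^sup>* (foldl App (psubst \<sigma> t) us) (Lam (Var 0))"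
    and "replaces_Omega (foldl App (psubst \<sigma> t) us) (foldl App (psubst \<sigma> t') us)"
    using ro_foldl ro_psubst ro_refl unfolding solvable_iff by blast
  then obtain v where "beta\<^sup>*\<^sup>* (foldl App (psubst \<sigma> t') us) v" "replaces_Omega (Lam (Var 0)) v"
    using ro_beta_rtranclp by blast
  moreover from this have "v = Lam (Var 0)"
    by (auto elim!: ro_LamE ro_VarE simp: Omega_def)
  ultimately show ?thesis unfolding solvable_iff by blast
qed

lemma solvable_subst_Omega: "solvable (subst u x Omega) \<Longrightarrow> solvable (subst u x A)"
  by (rule ro_solvable) (auto simp: subst_def intro!: ro_psubst ro_refl ro_Omega)

section \<open>Positions and occurrences\<close>

lemma subterm_at_append: "subterm_at t (p @ q) = Option.bind (subterm_at t p) (\<lambda>u. subterm_at u q)"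
  by (induction t p rule: subterm_at.induct) auto

lemma subterm_at_Var: "subterm_at (Var i) p = (if p = [] then Some (Var i) else None)"
  by (cases p) auto

lemma binders_simps [simp]:
  "binders [] = 0" "binders (Fn # p) = binders p" "binders (Arg # p) = binders p"
  "binders (Body # p) = Suc (binders p)" "binders (p @ q) = binders p + binders q"
  by (auto simp: binders_def)

lemma up_power_Suc: "(up ^^ Suc n) \<sigma> = (up ^^ n) (up \<sigma>)"
  by (simp only: funpow_Suc_right comp_apply)

section \<open>Subterms and variable occurrences of substituted terms\<close>

lemma subterm_at_psubst:
  "subterm_at t p = Some u \<Longrightarrow> subterm_at (psubst \<sigma> t) p = Some (psubst ((up ^^ binders p) \<sigma>) u)"
proof (induction t p arbitrary: \<sigma> rule: subterm_at.induct)
  case (4 t p)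
  then have "subterm_at (psubst (up \<sigma>) t) p = Some (psubst ((up ^^ binders p) (up \<sigma>)) u)" by simp
  also have "(up ^^ binders p) (up \<sigma>) = (up ^^ binders (Body # p)) \<sigma>"
    by (simp only: binders_simps up_power_Suc)
  finally show ?case by (simp only: psubst.simps subterm_at.simps)
qed auto

lemma subterm_at_psubst_VarD:
  "subterm_at (psubst \<sigma> t) p = Some (Var v) \<Longrightarrow>
    \<exists>q s i. p = q @ s \<and> subterm_at t q = Some (Var i) \<and>
      subterm_at ((up ^^ binders q) \<sigma> i) s = Some (Var v)"
proof (induction t arbitrary: \<sigma> p)
  case (Var i)
  then show ?case by (intro exI[of _ "[]"] exI[of _ p] exI[of _ i]) simp
next
  case (App t u)
  then consider p' where "p = Fn # p'" "subterm_at (psubst \<sigma> t) p' = Some (Var v)"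
    | p' where "p = Arg # p'" "subterm_at (psubst \<sigma> u) p' = Some (Var v)"
  proof (cases p)
    case (Cons d p')
    with App.prems that show ?thesis by (cases d) auto
  qed (use App.prems in simp)
  then show ?case
  proof cases
    case 1
    with App.IH(1) obtain q s i where "p' = q @ s" "subterm_at t q = Some (Var i)"
      "subterm_at ((up ^^ binders q) \<sigma> i) s = Some (Var v)" by blast
    with 1 show ?thesis by (intro exI[of _ "Fn # q"] exI[of _ s] exI[of _ i]) simp
  next
    case 2
    with App.IH(2) obtain q s i where "p' = q @ s" "subterm_at u q = Some (Var i)"
      "subterm_at ((up ^^ binders q) \<sigma> i) s = Some (Var v)" by blast
    with 2 show ?thesis by (intro exI[of _ "Arg # q"] exI[of _ s] exI[of _ i]) simp
  qed
next
  case (Lam t)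
  then obtain p' where p': "p = Body # p'" "subterm_at (psubst (up \<sigma>) t) p' = Some (Var v)"
  proof (cases p)
    case (Cons d p')
    with Lam.prems that show ?thesis by (cases d) auto
  qed (use Lam.prems in simp)
  with Lam.IH obtain q s i where *: "p' = q @ s" "subterm_at t q = Some (Var i)"
    "subterm_at ((up ^^ binders q) (up \<sigma>) i) s = Some (Var v)" by blast
  have "(up ^^ binders q) (up \<sigma>) = (up ^^ binders (Body # q)) \<sigma>"
    by (simp only: binders_simps up_power_Suc)
  with * have "subterm_at ((up ^^ binders (Body # q)) \<sigma> i) s = Some (Var v)" by (simp only:)
  with * p'(1) show ?case
    by (intro exI[of _ "Body # q"] exI[of _ s] exI[of _ i]) (simp only: append.simps subterm_at.simps simp_thms)
qed

lemma up_power_cases: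
  obtains "i < n" "(up ^^ n) \<sigma> i = Var i"
  | j where "i = n + j" "(up ^^ n) \<sigma> i = rename ((+) n) (\<sigma> j)"
  by (metis less_or_eq_imp_le not_less le_Suc_ex up_power_ge up_power_less)

lemma subterm_at_rename_plus_VarD:
  assumes "subterm_at (rename ((+) n) t) p = Some (Var (w + n + binders p))"
  shows "subterm_at t p = Some (Var (w + binders p))"
proof -
  let ?\<sigma> = "Var \<circ> (+) n"
  obtain q s i where q: "p = q @ s" "subterm_at t q = Some (Var i)"
    "subterm_at ((up ^^ binders q) ?\<sigma> i) s = Some (Var (w + n + binders p))"
    using assms subterm_at_psubst_VarD unfolding rename_eq_psubst by blast
  show ?thesis
    using q by (cases rule: up_power_cases[of i "binders q" ?\<sigma>])
      (auto simp: subterm_at_Var add_ac split: if_splits)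
qed

text \<open>In a contractum, an occurrence of an outer variable either was already in the body, with
  its index one higher because of the removed binder, or lies in a copy of the argument placed at an
  occurrence of the bound variable.\<close>

lemma occurrence_psubst_case_natD:
  assumes "subterm_at (psubst (case_nat b Var) t) p = Some (Var (w + binders p))"
  shows "subterm_at t p = Some (Var (Suc w + binders p)) \<or>
    (\<exists>q s. p = q @ s \<and> occurrence 0 t q \<and> occurrence w b s)"
proof -
  let ?\<sigma> = "case_nat b Var"
  obtain q s i where q: "p = q @ s" "subterm_at t q = Some (Var i)"
    "subterm_at ((up ^^ binders q) ?\<sigma> i) s = Some (Var (w + binders p))"
    using assms subterm_at_psubst_VarD by blast
  show ?thesis
  proof (cases rule: up_power_cases[of i "binders q" ?\<sigma>])
    case 1
    with q show ?thesis by (auto simp: subterm_at_Var split: if_splits)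
  next
    case (2 j)
    show ?thesis
    proof (cases j)
      case 0
      with q 2 subterm_at_rename_plus_VarD[of "binders q" b s w] show ?thesis
        by (auto simp: occurrence_def add_ac)
    next
      case (Suc k)
      with q 2 show ?thesis by (auto simp: subterm_at_Var add_ac split: if_splits)
    qed
  qed
qed

section \<open>Residues of occurrences under one contraction\<close>

lemma beta_at_redex:
  "beta_at r t t' \<Longrightarrow> \<exists>a b. subterm_at t r = Some (App (Lam a) b) \<and>
    subterm_at t' r = Some (psubst (case_nat b Var) a)"
  by (induction rule: beta_at.induct) auto

lemma beta_at_parallel:
  "beta_at r t t' \<Longrightarrow> \<not> prefix r p \<Longrightarrow> \<not> prefix p r \<Longrightarrow> subterm_at t' p = subterm_at t p"
proof (induction arbitrary: p rule: beta_at.induct)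
  case (2 r t t' u)
  then show ?case by (cases p; cases "hd p") auto
next
  case (3 r u u' t)
  then show ?case by (cases p; cases "hd p") auto
next
  case (4 r t t')
  then show ?case by (cases p; cases "hd p") auto
qed simp

lemma beta_at_above:
  "beta_at r t t' \<Longrightarrow> prefix p r \<Longrightarrow>
    \<exists>u u'. subterm_at t p = Some u \<and> subterm_at t' p = Some u' \<and> beta u u'"
proof (induction arbitrary: p rule: beta_at.induct)
  case (1 t u)
  then show ?case by (simp add: beta_redex)
next
  case (2 r t t' u)
  then show ?case by (cases p) (auto simp: beta_def intro: beta_at.intros)
next
  case (3 r u u' t)
  then show ?case by (cases p) (auto simp: beta_def intro: beta_at.intros)
next
  case (4 r t t')
  then show ?case by (cases p) (auto simp: beta_def intro: beta_at.intros)
qed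

lemma occurrence_not_above:
  "subterm_at t r = Some (App u v) \<Longrightarrow> occurrence x t p \<Longrightarrow> \<not> prefix p r"
  by (auto simp: occurrence_def prefix_def subterm_at_append subterm_at_Var split: if_splits)

lemma residue1_occurrence:
  assumes beta: "beta_at r t t'" and occ: "occurrence x t p" and "residue1 t r p p'"
  shows "occurrence x t' p'"
proof -
  obtain a b where ab: "subterm_at t r = Some (App (Lam a) b)"
    "subterm_at t' r = Some (psubst (case_nat b Var) a)"
    using beta_at_redex[OF beta] by blast
  from assms(3) show ?thesis
  proof cases
    case 1
    then show ?thesis
      using occ beta_at_parallel[OF beta] occurrence_not_above[OF ab(1) occ] by (simp add: occurrence_def)
  next
    case (2 q)
    have "subterm_at a q = Some (Var (binders q + Suc (x + binders r)))"
      using occ ab by (simp add: 2 occurrence_def subterm_at_append add_ac)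
    from subterm_at_psubst[OF this, of "case_nat b Var"] show ?thesis
      using ab up_power_ge[of "binders q" "case_nat b Var" "Suc (x + binders r)"]
      by (simp add: 2 occurrence_def subterm_at_append add_ac)
  next
    case (3 c y q)
    then have "subterm_at a y = Some (Var (binders y + 0))"
      using ab by (simp add: occurrence_def subterm_at_append)
    from subterm_at_psubst[OF this, of "case_nat b Var"]
    have y: "subterm_at (psubst (case_nat b Var) a) y = Some (psubst (Var \<circ> (+) (binders y)) b)"
      unfolding psubst.simps up_power_ge by (simp add: rename_eq_psubst)
    have "subterm_at b q = Some (Var (binders q + (x + binders r)))"
      using occ ab by (simp add: 3 occurrence_def subterm_at_append add_ac)
    from subterm_at_psubst[OF this, of "Var \<circ> (+) (binders y)"] show ?thesis
      using ab y up_power_ge[of "binders q" "Var \<circ> (+) (binders y)" "x + binders r"]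
      by (simp add: 3 occurrence_def subterm_at_append add_ac)
  qed
qed

text \<open>Contraction creates no new occurrence of a free variable: the two possible origins in a
  contractum correspond to the last two rules of \<open>residue1\<close>, and everything outside the
  redex stays in place.\<close>

lemma residue1_ancestor:
  assumes beta: "beta_at r t t'" and occ: "occurrence x t' p'"
  shows "\<exists>p. residue1 t r p p' \<and> occurrence x t p"
proof -
  obtain a b where ab: "subterm_at t r = Some (App (Lam a) b)"
    "subterm_at t' r = Some (psubst (case_nat b Var) a)"
    using beta_at_redex[OF beta] by blast
  show ?thesis
  proof (cases "prefix r p'")
    case False
    then have "\<not> prefix p' r"
      using occ ab by (auto simp: occurrence_def prefix_def subterm_at_append subterm_at_Var split: if_splits)
    with False occ beta_at_parallel[OF beta] have "occurrence x t p'" by (simp add: occurrence_def)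
    with False show ?thesis by (blast intro: residue1.intros)
  next
    case True
    then obtain s where s: "p' = r @ s" by (rule prefixE)
    then have "subterm_at (psubst (case_nat b Var) a) s = Some (Var ((x + binders r) + binders s))"
      using occ ab by (simp add: occurrence_def subterm_at_append add_ac)
    from occurrence_psubst_case_natD[OF this] consider
      "subterm_at a s = Some (Var (Suc (x + binders r) + binders s))"
      | y q where "s = y @ q" "occurrence 0 a y" "occurrence (x + binders r) b q"
      by blast
    then show ?thesis
    proof cases
      case 1
      with ab have "occurrence x t (r @ [Fn, Body] @ s)"
        by (simp add: occurrence_def subterm_at_append add_ac)
      then show ?thesis using residue1.intros(2) s by blast
    next
      case 2
      with ab have "occurrence x t (r @ [Arg] @ q)" "subterm_at t (r @ [Fn, Body]) = Some a"
        by (simp_all add: occurrence_def subterm_at_append add_ac)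
      then show ?thesis using residue1.intros(3) s 2 by blast
    qed
  qed
qed

section \<open>Ancestors of pure and good occurrences\<close>

text \<open>Dropping a nonempty block of final \<open>Fn\<close> steps from \<open>p\<close> reaches
  an application node \<open>c\<close>, whose argument sits at \<open>c @ [Arg]\<close>. This form
  frees later proofs from list arithmetic.\<close>

lemma set_args: "set (args p) = {c @ [Arg] | c m. p = c @ replicate (Suc m) Fn}"
proof (intro set_eqI iffI)
  fix a assume "a \<in> set (args p)"
  then obtain i where a: "a = take (length p - Suc i) p @ [Arg]"
    and i: "i < length (takeWhile (\<lambda>d. d = Fn) (rev p))"
    by (auto simp: args_def)
  have "Suc i \<le> length p" using i length_takeWhile_le[of _ "rev p"] by (metis Suc_leI length_rev less_le_trans)
  have "take (Suc i) (takeWhile (\<lambda>d. d = Fn) (rev p)) = take (Suc i) (rev p)"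
    using i by (subst takeWhile_eq_take) simp
  then have "\<forall>d \<in> set (take (Suc i) (rev p)). d = Fn"
    by (metis (mono_tags, lifting) in_set_takeD set_takeWhileD)
  with \<open>Suc i \<le> length p\<close> have "drop (length p - Suc i) p = replicate (Suc i) Fn"
    by (intro replicate_eqI) (auto simp: take_rev)
  then show "a \<in> {c @ [Arg] | c m. p = c @ replicate (Suc m) Fn}"
    using a by (metis (mono_tags, lifting) append_take_drop_id mem_Collect_eq)
next
  fix a assume "a \<in> {c @ [Arg] | c m. p = c @ replicate (Suc m) Fn}"
  then obtain c m where a: "a = c @ [Arg]" "p = c @ replicate (Suc m) Fn" by blast
  have "rev p = replicate (Suc m) Fn @ rev c" using a by (simp add: replicate_append_same)
  then have "m < length (takeWhile (\<lambda>d. d = Fn) (rev p))"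
    by (subst \<open>rev p = _\<close>, subst takeWhile_append2) auto
  moreover have "a = take (length p - Suc m) p @ [Arg]" using a by simp
  ultimately show "a \<in> set (args p)" unfolding args_def by auto
qed

lemma append_replicate_Fn:
  assumes "p @ d # s = c @ replicate n Fn" "d \<noteq> Fn"
  shows "\<exists>s'. c = p @ d # s'"
proof -
  consider us where "p = c @ us" "us @ d # s = replicate n Fn"
    | us where "p @ us = c" "d # s = us @ replicate n Fn"
    using assms(1) by (auto simp: append_eq_append_conv2)
  then show ?thesis
  proof cases
    case 1
    then have "d \<in> set (replicate n Fn)" by (metis in_set_conv_decomp)
    with assms(2) show ?thesis by simp
  next
    case 2
    with assms(2) show ?thesis by (cases us; cases n) auto
  qed
qed

text \<open>The condition that the two occurrences differ is automatic, since after \<open>c\<close>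
  one path continues with \<open>Fn\<close> and the other with \<open>Arg\<close>.\<close>

lemma pure_occ_iff:
  "pure_occ x t p \<longleftrightarrow> occurrence x t p \<and>
    \<not> (\<exists>c m. occurrence x t (c @ replicate (Suc m) Fn) \<and> prefix (c @ [Arg]) p)"
proof -
  have "c @ replicate (Suc m) Fn \<noteq> p" if "prefix (c @ [Arg]) p" for c m
    using that by (auto simp: prefix_def)
  then show ?thesis unfolding pure_occ_def set_args by blast
qed

text \<open>If the head \<open>q\<close> is not inside the redex, it stays and its arguments stay
  with it. Otherwise its whole applicative context lies in the body or in the argument of the redex
  and moves as a block, so for a copied argument the residue of \<open>q\<close> is taken in the
  same copy as \<open>p'\<close>.\<close>

lemma residue1_inside_argument:
  assumes redex: "subterm_at t r = Some (App (Lam a) b)"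
    and occ: "occurrence x t q" and q: "q = c @ replicate n Fn" and p: "prefix (c @ [Arg]) p"
    and res: "residue1 t r p p'"
  shows "\<exists>c'. residue1 t r q (c' @ replicate n Fn) \<and> prefix (c' @ [Arg]) p'"
proof -
  \<comment> \<open>Below \<open>r\<close> the path to a variable passes through \<open>Body\<close>
    or \<open>Arg\<close>. That step cannot belong to the final block of \<open>Fn\<close>, so it
    already lies in \<open>c\<close>; in particular the redex itself is not part of the applicative
    context of \<open>q\<close>.\<close>
  have below: "(\<exists>s. c = r @ [Fn, Body] @ s) \<or> (\<exists>s. c = r @ [Arg] @ s)" if "prefix r q"
  proof -
    obtain w where w: "q = r @ w" using \<open>prefix r q\<close> by (rule prefixE)
    then have "subterm_at (App (Lam a) b) w = Some (Var (x + binders q))"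
      using redex occ by (simp add: occurrence_def subterm_at_append)
    moreover have "\<exists>w'. w = Fn # Body # w' \<or> w = Arg # w'"
      if "subterm_at (App (Lam a) b) w = Some (Var i)" for i
      using that by (induction "App (Lam a) b" w rule: subterm_at.induct)
        (auto elim: subterm_at.elims)
    ultimately consider w' where "w = Fn # Body # w'" | w' where "w = Arg # w'" by blast
    then show ?thesis
    proof cases
      case 1
      then have "(r @ [Fn]) @ Body # w' = c @ replicate n Fn" using w q by simp
      from append_replicate_Fn[OF this] show ?thesis by auto
    next
      case 2
      then have "r @ Arg # w' = c @ replicate n Fn" using w q by simp
      from append_replicate_Fn[OF this] show ?thesis by auto
    qed
  qed
  have outside: "prefix (c @ [Arg]) r" if "\<not> prefix r q" "prefix r p"
  proof -
    have "\<not> prefix r c" using \<open>\<not> prefix r q\<close> q by auto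
    with prefix_same_cases[OF p \<open>prefix r p\<close>] show ?thesis by auto
  qed
  show ?thesis
  proof (cases "prefix r q")
    case False
    then have "residue1 t r q (c @ replicate n Fn)" using q residue1.intros(1) by blast
    moreover from res have "prefix (c @ [Arg]) p'"
    proof cases
      case 1
      then show ?thesis using p by simp
    qed (use outside[OF False] in auto)
    ultimately show ?thesis by blast
  next
    case True
    from res show ?thesis
    proof cases
      case 1
      then show ?thesis using below[OF True] p by (auto dest: append_prefixD)
    next
      case (2 s)
      then obtain s' where s': "c = r @ [Fn, Body] @ s'" using below[OF True] p by auto
      then have "residue1 t r q ((r @ s') @ replicate n Fn)"
        using residue1.intros(2)[of t r "s' @ replicate n Fn"] q by simp
      moreover have "prefix ((r @ s') @ [Arg]) p'" using p s' 2 by simp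
      ultimately show ?thesis by blast
    next
      case (3 d y s)
      then obtain s' where s': "c = r @ [Arg] @ s'" using below[OF True] p by auto
      then have "residue1 t r q ((r @ y @ s') @ replicate n Fn)"
        using residue1.intros(3)[of t r d y "s' @ replicate n Fn"] q 3 by simp
      moreover have "prefix ((r @ y @ s') @ [Arg]) p'" using p s' 3 by simp
      ultimately show ?thesis by blast
    qed
  qed
qed

lemma residue1_pure:
  assumes beta: "beta_at r t t'" and res: "residue1 t r p p'"
    and occ: "occurrence x t p" and pure: "pure_occ x t' p'"
  shows "pure_occ x t p"
  unfolding pure_occ_iff
proof (intro conjI occ notI)
  assume "\<exists>c m. occurrence x t (c @ replicate (Suc m) Fn) \<and> prefix (c @ [Arg]) p"
  then obtain c m where c: "occurrence x t (c @ replicate (Suc m) Fn)" "prefix (c @ [Arg]) p" by blast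
  obtain a b where "subterm_at t r = Some (App (Lam a) b)" using beta_at_redex[OF beta] by blast
  from residue1_inside_argument[OF this c(1) refl c(2) res] obtain c'
    where "residue1 t r (c @ replicate (Suc m) Fn) (c' @ replicate (Suc m) Fn)" "prefix (c' @ [Arg]) p'"
    by blast
  with residue1_occurrence[OF beta c(1)] pure show False unfolding pure_occ_iff by blast
qed

text \<open>This is the solvability half of goodness, read in a term where the substitution has
  already been performed.\<close>

definition solvable_along :: "tm \<Rightarrow> pos \<Rightarrow> bool" where
  "solvable_along t p \<longleftrightarrow> (\<forall>q u. prefix q p \<longrightarrow> subterm_at t q = Some u \<longrightarrow> solvable u)"

lemma solvable_alongD:
  "solvable_along t p \<Longrightarrow> prefix q p \<Longrightarrow> subterm_at t q = Some u \<Longrightarrow> solvable u"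
  unfolding solvable_along_def by blast

text \<open>Only the copying rule looks into the term, and it asks for occurrences of a bound
  variable, which a lifted substitution leaves alone.\<close>

lemma residue1_psubst: "residue1 t r p p' \<Longrightarrow> residue1 (psubst \<sigma> t) r p p'"
proof (induction rule: residue1.cases)
  case (3 b y q)
  let ?\<tau> = "(up ^^ binders (r @ [Fn, Body])) \<sigma>"
  have b: "subterm_at (psubst \<sigma> t) (r @ [Fn, Body]) = Some (psubst ?\<tau> b)"
    by (rule subterm_at_psubst) (rule 3)
  have "?\<tau> 0 = Var 0" by (rule up_power_less) simp
  with up_power_ge[of "binders y" ?\<tau> 0] have "(up ^^ binders y) ?\<tau> (binders y) = Var (binders y)"
    by (simp only: rename.simps add_0_right)
  moreover have "subterm_at b y = Some (Var (binders y))" using 3 by (simp add: occurrence_def)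
  ultimately have "occurrence 0 (psubst ?\<tau> b) y"
    unfolding occurrence_def using subterm_at_psubst by (metis add_0 psubst.simps(1))
  with b show ?case unfolding 3 by (rule residue1.intros(3))
next
  case 1
  then show ?case by (simp add: residue1.intros(1))
next
  case (2 q)
  show ?case unfolding 2 by (rule residue1.intros(2))
qed

lemma solvable_along_ancestor:
  assumes beta: "beta_at r t t'" and res: "residue1 t r p p'" and sol: "solvable_along t' p'"
  shows "solvable_along t p"
  unfolding solvable_along_def
proof (intro allI impI)
  fix q u assume q: "prefix q p" and u: "subterm_at t q = Some u"
  obtain a b where ab: "subterm_at t r = Some (App (Lam a) b)"
    "subterm_at t' r = Some (psubst (case_nat b Var) a)"
    using beta_at_redex[OF beta] by blast
  have above: "solvable u" if qr: "prefix q r" "prefix q p'"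
  proof -
    obtain v v' where v: "subterm_at t q = Some v" "subterm_at t' q = Some v'" "beta v v'"
      using beta_at_above[OF beta qr(1)] by blast
    have "solvable v'" using solvable_alongD[OF sol qr(2) v(2)] .
    with v u show ?thesis using solvable_beta_expand by simp
  qed
  from res show "solvable u"
  proof cases
    case 1
    show ?thesis
    proof (cases "prefix q r")
      case True
      with above q 1 show ?thesis by simp
    next
      case False
      moreover have "\<not> prefix r q" using q 1 by (meson prefix_order.order_trans)
      ultimately have "subterm_at t' q = Some u" using beta_at_parallel[OF beta] u by simp
      with sol q 1 show ?thesis using solvable_alongD by blast
    qed
  next
    case (2 s)
    from q have "prefix q r \<or> (\<exists>w. q = r @ Fn # w \<and> prefix w (Body # s))"
      unfolding 2(1) prefix_append by (auto simp: prefix_Cons)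
    then show ?thesis
    proof (elim disjE exE conjE)
      assume "prefix q r"
      then show ?thesis using above 2 by auto
    next
      fix w assume w: "q = r @ Fn # w" "prefix w (Body # s)"
      \<comment> \<open>A subterm of the body on the path to \<open>p\<close> has a substitution
        instance on the path to \<open>p'\<close>, and solvability of an instance implies
        solvability of the term.\<close>
      have a: "solvable v" if v: "subterm_at a w' = Some v" "prefix w' s" for w' v
      proof -
        have "subterm_at t' (r @ w') = Some (psubst ((up ^^ binders w') (case_nat b Var)) v)"
          using ab(2) subterm_at_psubst[OF v(1)] by (simp add: subterm_at_append)
        moreover have "prefix (r @ w') p'" using v(2) 2(2) by simp
        ultimately show ?thesis using solvable_alongD[OF sol] solvable_psubstD by blast
      qed
      show ?thesis
      proof (cases w)
        \<comment> \<open>The abstraction of the redex has no counterpart in the contractum; it is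
          handled through its body.\<close>
        case Nil
        with u ab w have "u = Lam a" by (simp add: subterm_at_append)
        then show ?thesis using a[of "[]" a] solvable_Lam by simp
      next
        case (Cons d w')
        with w have w': "d = Body" "prefix w' s" by auto
        with u ab w Cons have "subterm_at a w' = Some u" by (simp add: subterm_at_append)
        with w' a show ?thesis by blast
      qed
    qed
  next
    case (3 d y s)
    from q have "prefix q r \<or> (\<exists>w. q = r @ Arg # w \<and> prefix w s)"
      unfolding 3(1) prefix_append by (auto simp: prefix_Cons)
    then show ?thesis
    proof (elim disjE exE conjE)
      assume "prefix q r"
      then show ?thesis using above 3 by auto
    next
      fix w assume w: "q = r @ Arg # w" "prefix w s"
      have d: "d = a" using 3(3) ab by (simp add: subterm_at_append)
      have bw: "subterm_at b w = Some u" using u ab w by (simp add: subterm_at_append)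
      have "subterm_at a y = Some (Var (binders y + 0))" using 3(4) d by (simp add: occurrence_def)
      from subterm_at_psubst[OF this, of "case_nat b Var"]
      have "subterm_at (psubst (case_nat b Var) a) y = Some (psubst (Var \<circ> (+) (binders y)) b)"
        unfolding psubst.simps up_power_ge by (simp add: rename_eq_psubst)
      with ab(2) subterm_at_psubst[OF bw]
      \<comment> \<open>The copy of \<open>b\<close> at \<open>y\<close> is shifted past the binders
        above \<open>y\<close>. A shift is a substitution by variables, so the copied subterm is
        again an instance of \<open>u\<close>.\<close>
      have "subterm_at t' (r @ y @ w) =
          Some (psubst ((up ^^ binders w) (Var \<circ> (+) (binders y))) u)"
        by (simp add: subterm_at_append)
      moreover have "prefix (r @ y @ w) p'" using w(2) 3(2) by simp
      ultimately show ?thesis using solvable_alongD[OF sol] solvable_psubstD by blast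
    qed
  qed
qed

text \<open>\<open>A\<close> is closed, so substituting at a subterm agrees with taking the subterm
  after substitution, with \<open>x\<close> shifted by the binders crossed. No prefix is lost, since
  every prefix of an occurrence is a position of \<open>t\<close>.\<close>

lemma good_occ_iff:
  assumes "closed A"
  shows "good_occ A x t p \<longleftrightarrow> pure_occ x t p \<and> solvable_along (subst t x A) p"
proof -
  have sub: "subterm_at (subst t x A) q = Some (subst u (x + binders q) A)"
    if "subterm_at t q = Some u" for q u
    using subterm_at_psubst[OF that, of "Var(x := A)"] unfolding subst_def up_power_fun_upd[OF assms] .
  have ex: "\<exists>u. subterm_at t q = Some u" if "occurrence x t p" "prefix q p" for q
    using that by (auto simp: occurrence_def prefix_def subterm_at_append bind_eq_Some_conv)
  have "(\<forall>q u. prefix q p \<longrightarrow> subterm_at t q = Some u \<longrightarrow> solvable (subst u (x + binders q) A))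
      \<longleftrightarrow> solvable_along (subst t x A) p" if "occurrence x t p"
    unfolding solvable_along_def using sub ex[OF that] by fastforce
  then show ?thesis unfolding good_occ_def pure_occ_def by blast
qed

lemma good_occ_ancestor1:
  assumes A: "closed A" and beta: "beta_at r t t'" and good: "good_occ A x t' p'"
  shows "\<exists>p. residue1 t r p p' \<and> good_occ A x t p"
proof -
  have pure: "pure_occ x t' p'" and sol: "solvable_along (subst t' x A) p'"
    using good good_occ_iff[OF A] by blast+
  obtain p where p: "residue1 t r p p'" "occurrence x t p"
    using residue1_ancestor[OF beta] pure unfolding pure_occ_def by blast
  have "pure_occ x t p" using residue1_pure[OF beta p pure] .
  moreover have "solvable_along (subst t x A) p"
    using solvable_along_ancestor[OF beta_at_psubst[OF beta] residue1_psubst[OF p(1)]] sol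
    unfolding subst_def .
  ultimately show ?thesis using p(1) good_occ_iff[OF A] by blast
qed

lemma good_occ_ancestor:
  assumes A: "closed A"
  shows "reduction t rs t' \<Longrightarrow> good_occ A x t' p' \<Longrightarrow> \<exists>p. residue t rs p p' \<and> good_occ A x t p"
proof (induction rs arbitrary: t)
  case (Cons r rs)
  then obtain u where u: "beta_at r t u" "reduction u rs t'" by auto
  with Cons obtain q where q: "residue u rs q p'" "good_occ A x u q" by blast
  from good_occ_ancestor1[OF A u(1) q(2)] obtain p where "residue1 t r p q" "good_occ A x t p"
    by blast
  with u(1) q(1) show ?case unfolding residue.simps by blast
qed auto

section \<open>Existence of good occurrences\<close>

lemma omega_red_rtranclp_App:
  "omega_red\<^sup>*\<^sup>* t t' \<Longrightarrow> omega_red\<^sup>*\<^sup>* u u' \<Longrightarrow> omega_red\<^sup>*\<^sup>* (App t u) (App t' u')"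
  using rtranclp_map[of omega_red t t' omega_red "\<lambda>t. App t u"]
    rtranclp_map[of omega_red u u' omega_red "App t'"]
  by (meson omega_red.intros rtranclp_trans)

lemma omega_red_rtranclp_Lam: "omega_red\<^sup>*\<^sup>* t t' \<Longrightarrow> omega_red\<^sup>*\<^sup>* (Lam t) (Lam t')"
  by (erule rtranclp_map) (rule omega_red.intros)

lemma solvable_along_Cons:
  assumes "solvable t"
    and "\<And>u. subterm_at t [d] = Some u \<Longrightarrow> solvable_along u p"
  shows "solvable_along t (d # p)"
  unfolding solvable_along_def
proof (intro allI impI)
  fix q v assume q: "prefix q (d # p)" "subterm_at t q = Some v"
  show "solvable v"
  proof (cases q)
    case Nil
    with q assms(1) show ?thesis by simp
  next
    case (Cons e w)
    with q have w: "e = d" "prefix w p" by auto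
    have "subterm_at t ([d] @ w) = Some v" using q Cons w by simp
    then obtain u where "subterm_at t [d] = Some u" "subterm_at u w = Some v"
      unfolding subterm_at_append by (auto simp: bind_eq_Some_conv)
    with assms(2) w show ?thesis using solvable_alongD by blast
  qed
qed

text \<open>If every occurrence of \<open>x\<close> lies in a subterm that becomes unsolvable when \<open>A\<close> is put
  for \<open>x\<close>, contracting the outermost such subterms to \<open>\<Omega>\<close> erases the difference
  between \<open>A\<close> and \<open>\<Omega>\<close>.\<close>

lemma common_omega_reduct:
  assumes A: "closed A"
  shows "(\<And>p. occurrence x t p \<Longrightarrow> \<not> solvable_along (subst t x A) p) \<Longrightarrow>
    \<exists>w. omega_red\<^sup>*\<^sup>* (subst t x A) w \<and> omega_red\<^sup>*\<^sup>* (subst t x Omega) w"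
proof (induction t arbitrary: x)
  case (Var i)
  show ?case
  proof (cases "i = x")
    case True
    then have "occurrence x (Var i) []" by (simp add: occurrence_def)
    \<comment> \<open>The only prefix to test is the root, where the instance is \<open>A\<close>
      itself; so \<open>A\<close> contracts to \<open>Omega\<close>, which is the other
      instance.\<close>
    from Var[OF this] have "\<not> solvable A" using True by (simp add: solvable_along_def subst_def)
    then show ?thesis using True by (auto simp: subst_def intro: omega_red.intros)
  qed (auto simp: subst_def)
next
  case (App t u)
  show ?case
  proof (cases "solvable (subst (App t u) x A)")
    case False
    then show ?thesis using solvable_subst_Omega omega_red.intros(1) by blast
  next
    case True
    then have sol: "solvable (App (subst t x A) (subst u x A))" by (simp add: subst_def)
    have "\<not> solvable_along (subst t x A) p" if "occurrence x t p" for p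
      using App.prems[of "Fn # p"] solvable_along_Cons[OF sol, of Fn p] that
      by (auto simp: occurrence_def subst_def)
    moreover have "\<not> solvable_along (subst u x A) p" if "occurrence x u p" for p
      using App.prems[of "Arg # p"] solvable_along_Cons[OF sol, of Arg p] that
      by (auto simp: occurrence_def subst_def)
    ultimately obtain v w where
      "omega_red\<^sup>*\<^sup>* (subst t x A) v" "omega_red\<^sup>*\<^sup>* (subst t x Omega) v"
      "omega_red\<^sup>*\<^sup>* (subst u x A) w" "omega_red\<^sup>*\<^sup>* (subst u x Omega) w"
      using App.IH by metis
    then show ?thesis unfolding subst_def psubst.simps using omega_red_rtranclp_App by blast
  qed
next
  case (Lam t)
  have subst_Lam: "subst (Lam t) x B = Lam (subst t (Suc x) B)" if "closed B" for B
    unfolding subst_def psubst.simps up_fun_upd[OF that] ..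
  show ?case
  proof (cases "solvable (subst (Lam t) x A)")
    case False
    then show ?thesis using solvable_subst_Omega omega_red.intros(1) by blast
  next
    case True
    then have sol: "solvable (Lam (subst t (Suc x) A))" by (simp add: subst_Lam A)
    have "\<not> solvable_along (subst t (Suc x) A) p" if "occurrence (Suc x) t p" for p
      using Lam.prems[of "Body # p"] solvable_along_Cons[OF sol, of Body p] that
      by (auto simp: occurrence_def subst_Lam A)
    with Lam.IH obtain w where
      "omega_red\<^sup>*\<^sup>* (subst t (Suc x) A) w" "omega_red\<^sup>*\<^sup>* (subst t (Suc x) Omega) w"
      by blast
    then show ?thesis
      unfolding subst_Lam[OF A] subst_Lam[OF closed_Omega] using omega_red_rtranclp_Lam by blast
  qed
qed

lemma beta_omega_rtranclp:
  "beta\<^sup>*\<^sup>* t u \<Longrightarrow> beta_omega\<^sup>*\<^sup>* t u" "omega_red\<^sup>*\<^sup>* t u \<Longrightarrow> beta_omega\<^sup>*\<^sup>* t u"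
  by (erule rtranclp_map[where f = "\<lambda>t. t", simplified]; simp add: beta_omega_def)+

lemma good_occ_exists:
  assumes A: "closed A" and "\<not> subst t x A \<simeq> subst t x Omega"
  shows "\<exists>p. good_occ A x t p"
proof -
  let ?P = "\<lambda>p. occurrence x t p \<and> solvable_along (subst t x A) p"
  have "\<exists>p. ?P p"
  proof (rule ccontr)
    assume "\<not> (\<exists>p. ?P p)"
    then obtain w where "omega_red\<^sup>*\<^sup>* (subst t x A) w" "omega_red\<^sup>*\<^sup>* (subst t x Omega) w"
      using common_omega_reduct[OF A] by metis
    then have "subst t x A \<simeq> subst t x Omega" unfolding sim_def using beta_omega_rtranclp by blast
    with assms(2) show False by blast
  qed
  \<comment> \<open>Minimality yields purity: an occurrence with \<open>p\<close> inside one of its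
    arguments has strictly fewer \<open>Arg\<close> steps, and below it is shown to satisfy
    \<open>?P\<close> too.\<close>
  then obtain p where p: "?P p" and
    least: "\<And>q. ?P q \<Longrightarrow> count_list p Arg \<le> count_list q Arg"
    using ex_has_least_nat[of ?P _ "\<lambda>p. count_list p Arg"] by blast
  have "pure_occ x t p"
    unfolding pure_occ_iff
  proof (intro conjI notI)
    show "occurrence x t p" using p by blast
    assume "\<exists>c m. occurrence x t (c @ replicate (Suc m) Fn) \<and> prefix (c @ [Arg]) p"
    then obtain c m where q: "occurrence x t (c @ replicate (Suc m) Fn)" and c: "prefix (c @ [Arg]) p"
      by blast
    \<comment> \<open>The path to the competing occurrence shares \<open>c\<close> with
      \<open>p\<close> and then only enters function parts, so solvability descends from the node at
      \<open>c\<close>.\<close>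
    have Fn: "solvable u" if "subterm_at (subst t x A) (c @ replicate n Fn) = Some u" for n u
      using that
    proof (induction n arbitrary: u)
      case 0
      then show ?case
        using p solvable_alongD append_prefixD[OF c] by (metis append_Nil2 replicate_0)
    next
      case (Suc n)
      then have "subterm_at (subst t x A) ((c @ replicate n Fn) @ [Fn]) = Some u"
        by (simp add: replicate_append_same)
      then obtain v where v: "subterm_at (subst t x A) (c @ replicate n Fn) = Some v"
        "subterm_at v [Fn] = Some u"
        unfolding subterm_at_append by (auto simp: bind_eq_Some_conv)
      then obtain u' where "v = App u u'" by (cases v) auto
      with Suc.IH[OF v(1)] show ?case using solvable_AppD by blast
    qed
    have "solvable_along (subst t x A) (c @ replicate (Suc m) Fn)"
      unfolding solvable_along_def
    proof (intro allI impI)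
      fix q u assume "prefix q (c @ replicate (Suc m) Fn)" and u: "subterm_at (subst t x A) q = Some u"
      then consider "prefix q c" | w where "q = c @ w" "prefix w (replicate (Suc m) Fn)"
        unfolding prefix_append by blast
      then show "solvable u"
      proof cases
        case 1
        then have "prefix q p" using append_prefixD[OF c] by (meson prefix_order.order_trans)
        with p u show ?thesis using solvable_alongD by blast
      next
        case 2
        then have "set w \<subseteq> {Fn}" using set_mono_prefix[OF 2(2)] by (simp only: set_replicate_Suc)
        then have "w = replicate (length w) Fn" by (intro replicate_eqI) auto
        with 2 u Fn show ?thesis by metis
      qed
    qed
    with q least have "count_list p Arg \<le> count_list (c @ replicate (Suc m) Fn) Arg" by blast
    also have "\<dots> = count_list c Arg" by (induction m) auto
    also have "\<dots> < count_list p Arg" using c by (auto simp: prefix_def)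
    finally show False by simp
  qed
  with p good_occ_iff[OF A] show ?thesis by blast
qed

section \<open>Infinite branches\<close>

lemma finite_positions: "finite {p. subterm_at t p \<noteq> None}"
proof (induction t)
  case (Var i)
  have "{p. subterm_at (Var i) p \<noteq> None} = {[]}" by (auto simp: subterm_at_Var split: if_splits)
  then show ?case by simp
next
  case (App t u)
  have "{p. subterm_at (App t u) p \<noteq> None} \<subseteq>
      {[]} \<union> (#) Fn ` {p. subterm_at t p \<noteq> None} \<union> (#) Arg ` {p. subterm_at u p \<noteq> None}"
  proof
    fix p assume "p \<in> {p. subterm_at (App t u) p \<noteq> None}"
    then show "p \<in> {[]} \<union> (#) Fn ` {p. subterm_at t p \<noteq> None} \<union> (#) Arg ` {p. subterm_at u p \<noteq> None}"
      by (cases p; cases "hd p") auto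
  qed
  then show ?case by (rule finite_subset) (intro finite.intros finite_UnI finite_imageI App.IH)
next
  case (Lam t)
  have "{p. subterm_at (Lam t) p \<noteq> None} \<subseteq> {[]} \<union> (#) Body ` {p. subterm_at t p \<noteq> None}"
  proof
    fix p assume "p \<in> {p. subterm_at (Lam t) p \<noteq> None}"
    then show "p \<in> {[]} \<union> (#) Body ` {p. subterm_at t p \<noteq> None}"
      by (cases p; cases "hd p") auto
  qed
  then show ?case by (rule finite_subset) (intro finite.intros finite_UnI finite_imageI Lam.IH)
qed

text \<open>Climbing through parents from deep levels gives chains of every finite length starting
  at each level. Finiteness of the levels yields a node starting chains of all lengths, and this
  property is inherited by one of its successors.\<close>

lemma koenig_levels:
  fixes L :: "nat \<Rightarrow> 'a set" and S :: "nat \<Rightarrow> 'a \<Rightarrow> 'a \<Rightarrow> bool"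
  assumes fin: "\<And>k. finite (L k)" and ne: "\<And>k. L k \<noteq> {}"
    and parent: "\<And>k q. q \<in> L (Suc k) \<Longrightarrow> \<exists>p \<in> L k. S k p q"
  shows "\<exists>b. \<forall>k. b k \<in> L k \<and> S k (b k) (b (Suc k))"
proof -
  \<comment> \<open>\<open>D n k p\<close>: a chain of \<open>n\<close> further steps through the
    levels starts at the node \<open>p\<close> of level \<open>k\<close>.\<close>
  define D where "D = rec_nat (\<lambda>k p. p \<in> L k)
    (\<lambda>n E k p. p \<in> L k \<and> (\<exists>q. S k p q \<and> E (Suc k) q))"
  have D_0: "D 0 k p \<longleftrightarrow> p \<in> L k"
    and D_Suc: "D (Suc n) k p \<longleftrightarrow> p \<in> L k \<and> (\<exists>q. S k p q \<and> D n (Suc k) q)" for n k p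
    by (simp_all add: D_def)
  have D_L: "p \<in> L k" if "D n k p" for n k p
    using that by (cases n) (simp_all add: D_0 D_Suc)
  have D_ex: "\<exists>p. D n k p" for n k
  proof (induction n arbitrary: k)
    case 0
    then show ?case using ne by (auto simp: D_0)
  next
    case (Suc n)
    then obtain q where q: "D n (Suc k) q" by blast
    with parent D_L obtain p where "p \<in> L k" "S k p q" by blast
    with q show ?case unfolding D_Suc by blast
  qed
  have D_mono: "D n k p" if "D m k p" "n \<le> m" for n m k p
    using that
  proof (induction n arbitrary: m k p)
    case 0
    then show ?case using D_L by (simp add: D_0)
  next
    case (Suc n)
    then obtain m' where m': "m = Suc m'" "n \<le> m'" by (cases m) auto
    with Suc.prems(1) obtain q where "p \<in> L k" "S k p q" "D m' (Suc k) q"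
      unfolding m' D_Suc by blast
    with Suc.IH m'(2) show ?case unfolding D_Suc by blast
  qed
  \<comment> \<open>If each \<open>p\<close> in \<open>X\<close> failed at some length
    \<open>f p\<close>, a node of \<open>X\<close> starting a chain as long as the maximum of these
    lengths would contradict \<open>D_mono\<close>.\<close>
  have compact: "\<exists>p \<in> X. \<forall>n. D n k p"
    if "finite X" and ex: "\<And>n. \<exists>p \<in> X. D n k p" for X k
  proof (rule ccontr)
    assume "\<not> ?thesis"
    then obtain f where f: "\<And>p. p \<in> X \<Longrightarrow> \<not> D (f p) k p" by metis
    obtain p where p: "p \<in> X" "D (Max (f ` X)) k p" using ex by blast
    have "f p \<le> Max (f ` X)" using \<open>finite X\<close> p(1) by simp
    with p f D_mono show False by blast
  qed
  have "\<exists>b. \<forall>k. (\<forall>n. D n k (b k)) \<and> S k (b k) (b (Suc k))"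
  proof (rule dependent_nat_choice)
    show "\<exists>p. \<forall>n. D n 0 p" using compact[OF fin, of 0 0] D_ex D_L by blast
  next
    fix p k assume p: "\<forall>n. D n k p"
    \<comment> \<open>Removing the first step of a chain of length \<open>Suc n\<close> from
      \<open>p\<close> leaves one of length \<open>n\<close> from a successor, so
      \<open>compact\<close> applies to the set of successors.\<close>
    have "\<exists>q \<in> {q \<in> L (Suc k). S k p q}. D n (Suc k) q" for n
      using p[rule_format, of "Suc n"] D_L unfolding D_Suc by blast
    with compact[of "{q \<in> L (Suc k). S k p q}" "Suc k"] fin
    show "\<exists>q. (\<forall>n. D n (Suc k) q) \<and> S k p q" by auto
  qed
  then show ?thesis using D_L by metis
qed

lemma reduction_beta_rtranclp: "reduction t rs u \<Longrightarrow> beta\<^sup>*\<^sup>* t u"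
proof (induction rs arbitrary: t)
  case (Cons r rs)
  then obtain v where v: "beta_at r t v" "reduction v rs u" by auto
  then have "beta t v" unfolding beta_def by blast
  then show ?case using Cons.IH[OF v(2)] by (rule converse_rtranclp_into_rtranclp)
qed simp

theorem theorem2p9:
  fixes F A :: tm and x :: nat and Fs :: "nat \<Rightarrow> tm" and \<rho> :: "nat \<Rightarrow> pos list"
  assumes "\<not> normalizable F"
    and "FV F = {x}"
    and "x \<in> \<beta>\<Omega> F"
    and "closed A"
    and "\<not> (subst F x A \<simeq> subst F x Omega)"
    and "Fs 0 = F"
    and "\<And>k. reduction (Fs k) (\<rho> k) (Fs (Suc k))"
    and "\<And>G. beta\<^sup>*\<^sup>* F G \<Longrightarrow> \<exists>k. beta\<^sup>*\<^sup>* G (Fs k)"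
    and "recursive (\<lambda>k. code (Fs k))"
  shows "\<exists>b. infinite_branch x Fs \<rho> b \<and> (\<forall>k. good_occ A x (Fs k) (b k))"
proof -
  have red: "beta\<^sup>*\<^sup>* F (Fs k)" for k
  proof (induction k)
    case (Suc k)
    from this reduction_beta_rtranclp[OF assms(7)] show ?case by (rule rtranclp_trans)
  qed (simp add: assms(6))
  have red_subst: "beta_omega\<^sup>*\<^sup>* (subst F x B) (subst (Fs k) x B)" for k B
    unfolding subst_def
    by (rule beta_omega_rtranclp(1)) (rule rtranclp_map[where f = "psubst _", OF red], rule beta_psubst)
  \<comment> \<open>A common reduct at level \<open>k\<close> would also be a common reduct of the
    two instances of \<open>F\<close>, as these reduce to the instances of
    \<open>Fs k\<close>.\<close>
  have not_sim: "\<not> subst (Fs k) x A \<simeq> subst (Fs k) x Omega" for k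
    using assms(5) red_subst unfolding sim_def by (meson rtranclp_trans)
  have "\<exists>b. \<forall>k. b k \<in> {p. good_occ A x (Fs k) p} \<and> residue (Fs k) (\<rho> k) (b k) (b (Suc k))"
  proof (rule koenig_levels)
    fix k
    have "{p. good_occ A x (Fs k) p} \<subseteq> {p. subterm_at (Fs k) p \<noteq> None}"
      by (auto simp: good_occ_def pure_occ_def occurrence_def)
    then show "finite {p. good_occ A x (Fs k) p}" by (rule finite_subset) (rule finite_positions)
    show "{p. good_occ A x (Fs k) p} \<noteq> {}" using good_occ_exists[OF assms(4) not_sim] by blast
    show "\<exists>p \<in> {p. good_occ A x (Fs k) p}. residue (Fs k) (\<rho> k) p q"
      if "q \<in> {p. good_occ A x (Fs (Suc k)) p}" for q
      using good_occ_ancestor[OF assms(4,7)] that by blast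
  qed
  then show ?thesis
    by (auto simp: infinite_branch_def level_def son_def good_occ_def)
qed

end
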